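(* Let $c>0$, let $S_1,S_2\subseteq\mathbb{R}^k$ be sets that are $c$-equivalent at $x\in S_1\cap S_2$, and let $(h_n)$ be a sequence in $\mathbb{R}^k$ with $h_n=O(n^{-\frac1{2c}})$ and $x+h_n\in S_1$. Then there exists a sequence $\tilde h_n$ with $x+\tilde h_n\in S_2$ such that $\sqrt n\,(h_n-\tilde h_n)\to0$.
   Context: Hausdorff distance: $D(A,B)=\max\{\sup_{a\in A}\inf_{b\in B}\|a-b\|,\ \sup_{b\in B}\inf_{a\in A}\|a-b\|\}$. With $N_\varepsilon(x)$ the $\varepsilon$-ball around $x$, the sets $S_1,S_2$ are $c$-equivalent at $x\in S_1\cap S_2$ if $\lim_{\varepsilon\downarrow0}\varepsilon^{-c}D(S_1\cap N_\varepsilon(x),S_2\cap N_\varepsilon(x))=0$. *)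

theory Defs
  imports "HOL-Analysis.Analysis" "HOL-Library.Landau_Symbols"
begin

(* Real-valued, hence meaningful for nonempty bounded sets, where all suprema and infima are
   finite; below it is only applied to bounded sets containing a common point. *)
definition hausdorff_distance :: "'a::real_normed_vector set \<Rightarrow> 'a set \<Rightarrow> real" where
  "hausdorff_distance A B =
     max (SUP a\<in>A. INF b\<in>B. norm (a - b)) (SUP b\<in>B. INF a\<in>A. norm (a - b))"

(* The neighbourhoods of x are open balls. *)
definition c_equivalent_at ::
    "real \<Rightarrow> 'a::real_normed_vector set \<Rightarrow> 'a set \<Rightarrow> 'a \<Rightarrow> bool" where
  "c_equivalent_at c S1 S2 x \<longleftrightarrow>
     x \<in> S1 \<inter> S2 \<and>
     ((\<lambda>\<epsilon>. \<epsilon> powr (- c) * hausdorff_distance (S1 \<inter> ball x \<epsilon>) (S2 \<inter> ball x \<epsilon>))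
        \<longlongrightarrow> 0) (at_right 0)"

end

theory Submission
  imports Defs
begin

text \<open>
  The rate \<open>n powr (- 1 / (2 * c))\<close> is chosen so that its \<open>c\<close>-th power is \<open>1 / sqrt n\<close>. Since \<open>h n\<close> is
  of this order, \<open>x + h n\<close> lies in a ball around \<open>x\<close> of radius \<open>\<epsilon> n = K * n powr (- 1 / (2 * c))\<close>
  for a suitable constant \<open>K\<close> and all large \<open>n\<close>. Evaluated along the radii \<open>\<epsilon> n\<close>, \<open>c\<close>-equivalence
  says exactly that the Hausdorff distance of the two localised sets is \<open>o(1 / sqrt n)\<close>, as
  \<open>\<epsilon> n powr (- c)\<close> is \<open>sqrt n\<close> up to a constant factor
  (\<open>c_equivalent_at_imp_sqrt_scaled_hausdorff_distance\<close>). Hence \<open>x + h n\<close> has a point of \<open>S2\<close> within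
  that distance, up to an additional error of \<open>1 / n\<close> because the infimum over \<open>S2\<close> need not be
  attained (\<open>hausdorff_distance_near_point\<close>). Both errors vanish after multiplication by \<open>sqrt n\<close>.
\<close>

text \<open>
  Boundedness of \<open>A\<close> keeps the supremum over \<open>A\<close> from being a junk value: the infima are all bounded
  by the distances to one fixed point of \<open>B\<close>.
\<close>
lemma hausdorff_distance_near_point:
  fixes A B :: "'a::real_normed_vector set"
  assumes "bounded A" and "B \<noteq> {}" and "a \<in> A" and "\<delta> > 0"
  shows "\<exists>b\<in>B. norm (a - b) < hausdorff_distance A B + \<delta>"
proof -
  obtain b\<^sub>0 where b\<^sub>0: "b\<^sub>0 \<in> B"
    using \<open>B \<noteq> {}\<close> by blast
  obtain M where M: "\<And>y. y \<in> A \<Longrightarrow> norm y \<le> M"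
    using \<open>bounded A\<close> unfolding bounded_iff by blast
  have bdd_dist: "bdd_below ((\<lambda>b. norm (y - b)) ` B)" for y
    by (rule bdd_belowI2[where m = 0]) simp
  have "(INF b\<in>B. norm (y - b)) \<le> M + norm b\<^sub>0" if "y \<in> A" for y
  proof -
    have "(INF b\<in>B. norm (y - b)) \<le> norm (y - b\<^sub>0)"
      by (rule cINF_lower[OF bdd_dist b\<^sub>0])
    also have "\<dots> \<le> M + norm b\<^sub>0"
      using norm_triangle_ineq4[of y b\<^sub>0] M[OF that] by linarith
    finally show ?thesis .
  qed
  then have "bdd_above ((\<lambda>y. INF b\<in>B. norm (y - b)) ` A)"
    by (rule bdd_aboveI2)
  then have "(INF b\<in>B. norm (a - b)) \<le> (SUP y\<in>A. INF b\<in>B. norm (y - b))"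
    by (rule cSUP_upper[OF \<open>a \<in> A\<close>])
  also have "\<dots> \<le> hausdorff_distance A B"
    unfolding hausdorff_distance_def by simp
  finally have "(INF b\<in>B. norm (a - b)) < hausdorff_distance A B + \<delta>"
    using \<open>\<delta> > 0\<close> by simp
  then show ?thesis
    using cINF_less_iff[OF \<open>B \<noteq> {}\<close> bdd_dist] by blast
qed

lemma c_equivalent_at_imp_sqrt_scaled_hausdorff_distance:
  fixes x :: "'a::real_normed_vector"
  assumes "c > 0" and "K > 0" and equiv: "c_equivalent_at c S1 S2 x"
  defines "\<epsilon> \<equiv> \<lambda>n. K * real n powr (- (1 / (2 * c)))"
  shows "(\<lambda>n. sqrt (real n) *
           hausdorff_distance (S1 \<inter> ball x (\<epsilon> n)) (S2 \<inter> ball x (\<epsilon> n))) \<longlonglongrightarrow> 0"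
proof -
  define D where "D e = hausdorff_distance (S1 \<inter> ball x e) (S2 \<inter> ball x e)" for e
  have "(\<lambda>n. real n powr (- (1 / (2 * c)))) \<longlonglongrightarrow> 0"
    using \<open>c > 0\<close> by (intro tendsto_neg_powr filterlim_real_sequentially) auto
  then have "\<epsilon> \<longlonglongrightarrow> 0"
    unfolding \<epsilon>_def using tendsto_mult_right_zero by blast
  moreover have "\<forall>\<^sub>F n in sequentially. \<epsilon> n > 0"
    unfolding \<epsilon>_def
    by (rule eventually_mono[OF eventually_gt_at_top[of 0]]) (use \<open>K > 0\<close> in simp)
  ultimately have "filterlim \<epsilon> (at_right 0) sequentially"
    by (simp add: tendsto_imp_filterlim_at_right)
  then have "(\<lambda>n. \<epsilon> n powr (- c) * D (\<epsilon> n)) \<longlonglongrightarrow> 0"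
    using equiv unfolding c_equivalent_at_def D_def
    by (auto intro: filterlim_compose[of "\<lambda>e. e powr (- c) * _ e"])
  then have scaled: "(\<lambda>n. K powr c * (\<epsilon> n powr (- c) * D (\<epsilon> n))) \<longlonglongrightarrow> 0"
    by (rule tendsto_mult_right_zero)
  have "K powr c * \<epsilon> n powr (- c) = sqrt (real n)" for n
    using \<open>c > 0\<close> \<open>K > 0\<close>
    by (simp add: \<epsilon>_def powr_mult powr_powr powr_half_sqrt flip: powr_add mult.assoc)
  then have "K powr c * (\<epsilon> n powr (- c) * D (\<epsilon> n)) = sqrt (real n) * D (\<epsilon> n)" for n
    by (metis mult.assoc)
  with scaled show ?thesis
    unfolding D_def by simp
qed

theorem theorem2p10:
  fixes c :: real
    and S1 S2 :: "(real ^ 'k) set"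
    and x :: "real ^ 'k"
    and h :: "nat \<Rightarrow> real ^ 'k"
  assumes "c > 0"
    and "c_equivalent_at c S1 S2 x"
    and "(\<lambda>n. norm (h n)) \<in> O(\<lambda>n. real n powr (- (1 / (2 * c))))"
    and "\<And>n. n \<ge> 1 \<Longrightarrow> x + h n \<in> S1"
  shows "\<exists>h' :: nat \<Rightarrow> real ^ 'k.
           (\<forall>n\<ge>1. x + h' n \<in> S2) \<and>
           (\<lambda>n. sqrt (real n) *\<^sub>R (h n - h' n)) \<longlonglongrightarrow> 0"
proof -
  obtain C where C: "C > 0"
    "\<forall>\<^sub>F n in sequentially. norm (h n) \<le> C * real n powr (- (1 / (2 * c)))"
    using landau_o.bigE[OF assms(3)] by auto
  \<comment> \<open>The constant is enlarged because the balls are open.\<close>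
  define \<epsilon> where "\<epsilon> n = (C + 1) * real n powr (- (1 / (2 * c)))" for n
  define A where "A n = S1 \<inter> ball x (\<epsilon> n)" for n
  define B where "B n = S2 \<inter> ball x (\<epsilon> n)" for n
  define D where "D n = hausdorff_distance (A n) (B n)" for n
  have x: "x \<in> S2"
    using assms(2) unfolding c_equivalent_at_def by blast
  have in_A: "\<forall>\<^sub>F n in sequentially. n \<ge> 1 \<and> x + h n \<in> A n"
    using C(2) eventually_ge_at_top[of 1]
  proof eventually_elim
    case (elim n)
    then have "0 < real n powr (- (1 / (2 * c)))"
      by simp
    with elim have "norm (h n) < \<epsilon> n"
      unfolding \<epsilon>_def distrib_right by linarith
    with elim assms(4) show ?case
      unfolding A_def by (simp add: dist_norm)
  qed
  \<comment> \<open>At the finitely many indices where \<open>x + h n\<close> may lie outside the ball, \<open>b = x\<close> serves.\<close>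
  have "\<exists>b\<in>S2. n \<ge> 1 \<and> x + h n \<in> A n \<longrightarrow> norm (x + h n - b) < D n + 1 / real n" for n
  proof (cases "n \<ge> 1 \<and> x + h n \<in> A n")
    case True
    then have "\<epsilon> n > 0"
      unfolding \<epsilon>_def using C(1) by simp
    then have "B n \<noteq> {}"
      unfolding B_def using x centre_in_ball by blast
    moreover have "bounded (A n)"
      unfolding A_def by (simp add: bounded_Int)
    ultimately have "\<exists>b\<in>B n. norm (x + h n - b) < D n + 1 / real n"
      unfolding D_def using True by (intro hausdorff_distance_near_point) auto
    then show ?thesis
      unfolding B_def by blast
  qed (use x in auto)
  then obtain b where b: "\<And>n. b n \<in> S2"
    "\<And>n. n \<ge> 1 \<and> x + h n \<in> A n \<Longrightarrow> norm (x + h n - b n) < D n + 1 / real n"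
    by metis
  have "(\<lambda>n. sqrt (real n) * D n) \<longlonglongrightarrow> 0"
    using c_equivalent_at_imp_sqrt_scaled_hausdorff_distance[OF assms(1) _ assms(2), of "C + 1"] C(1)
    unfolding D_def A_def B_def \<epsilon>_def by simp
  moreover have "(\<lambda>n. 1 / sqrt (real n)) \<longlonglongrightarrow> 0"
    by (rule real_tendsto_divide_at_top[OF tendsto_const
          filterlim_compose[OF sqrt_at_top filterlim_real_sequentially]])
  ultimately have bound: "(\<lambda>n. sqrt (real n) * D n + 1 / sqrt (real n)) \<longlonglongrightarrow> 0"
    using tendsto_add_zero by blast
  have "(\<lambda>n. sqrt (real n) *\<^sub>R (h n - (b n - x))) \<longlonglongrightarrow> 0"
  proof (rule Lim_null_comparison[OF _ bound])
    show "\<forall>\<^sub>F n in sequentially. norm (sqrt (real n) *\<^sub>R (h n - (b n - x)))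
            \<le> sqrt (real n) * D n + 1 / sqrt (real n)"
      using in_A
    proof eventually_elim
      case (elim n)
      have "norm (sqrt (real n) *\<^sub>R (h n - (b n - x))) = sqrt (real n) * norm (x + h n - b n)"
        unfolding norm_scaleR by (simp add: diff_diff_eq2 add.commute)
      also have "\<dots> \<le> sqrt (real n) * (D n + 1 / real n)"
        using b(2)[OF elim] by (intro mult_left_mono) auto
      also have "\<dots> = sqrt (real n) * D n + 1 / sqrt (real n)"
        using elim by (simp add: distrib_left real_divide_square_eq field_simps)
      finally show ?case .
    qed
  qed
  with b(1) show ?thesis
    by (intro exI[of _ "\<lambda>n. b n - x"]) auto
qed

end
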